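(* Let $k\ge 1$ be an integer, let $g$ be a graph, let $S\subseteq V(g)$ be a $k$-defective clique, and let $lb\ge 0$ be an integer (the size of the currently found best solution). Let $v_1,v_2,\dots$ be an ordering of $V(g)\setminus S$ in non-decreasing order of $|\overline{N}_S(\cdot)|$. Suppose that $v_i$ is a vertex with $i>lb-|S|$ and $$|\overline{N}_S(v_i)|>k-|\overline{E}(S)|-\sum_{j=1}^{lb-|S|}|\overline{N}_S(v_j)|.$$ Then $v_i$ can be removed from $g$; that is, every $k$-defective clique $C$ with $S\cup\{v_i\}\subseteq C\subseteq V(g)$ satisfies $|C|\le lb$.
   Context: All graphs are finite, simple and undirected. For a vertex set $A\subseteq V(g)$, $\overline{E}(A)$ is the set of non-edges (unordered pairs of distinct non-adjacent vertices) of the subgraph of $g$ induced by $A$; $A$ is a $k$-defective clique if $|\overline{E}(A)|\le k$. $\overline{N}_S(u)$ denotes the set of vertices of $S$ that are different from $u$ and not adjacent to $u$ in $g$. In a branch-and-bound search for a maximum $k$-defective clique, with $lb$ the size of the best solution found so far, only solutions of size greater than $lb$ are of interest, so a vertex $v\in V(g)\setminus S$ "can be removed from $g$" if no $k$-defective clique of size greater than $lb$ in $g$ contains $S\cup\{v\}$. A sum whose upper limit is less than $1$ is empty and equals $0$. *)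

theory Defs
  imports "Graph_Theory.Pair_Digraph"
begin

text \<open>
  Finite simple undirected graphs are rendered by the locale \<^locale>\<open>pair_graph\<close>: finitely many
  vertices and a symmetric, irreflexive arc relation on them, so that two vertices \<open>u\<close> and \<open>v\<close>
  are adjacent iff \<open>(u, v) \<in> parcs G\<close>. Non-edges are unordered, hence two-element sets.
\<close>

definition nonedges :: "'a pair_pre_digraph \<Rightarrow> 'a set \<Rightarrow> 'a set set" where
  "nonedges G A = {{u, v} | u v. u \<in> A \<and> v \<in> A \<and> u \<noteq> v \<and> (u, v) \<notin> parcs G}"

definition defective_clique :: "'a pair_pre_digraph \<Rightarrow> nat \<Rightarrow> 'a set \<Rightarrow> bool" where
  "defective_clique G k A \<longleftrightarrow> A \<subseteq> pverts G \<and> card (nonedges G A) \<le> k"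

definition non_nbrs :: "'a pair_pre_digraph \<Rightarrow> 'a set \<Rightarrow> 'a \<Rightarrow> 'a set" where
  "non_nbrs G S u = {w \<in> S. w \<noteq> u \<and> (u, w) \<notin> parcs G}"

text \<open>\<open>lb\<close> is the size of the best solution found so far and \<open>S\<close> the current partial solution.\<close>

definition can_be_removed :: "'a pair_pre_digraph \<Rightarrow> nat \<Rightarrow> 'a set \<Rightarrow> nat \<Rightarrow> 'a \<Rightarrow> bool" where
  "can_be_removed G k S lb v \<longleftrightarrow>
     (\<nexists>C. defective_clique G k C \<and> card C > lb \<and> S \<union> {v} \<subseteq> C)"

end

theory Submission
  imports Defs
begin

text \<open>
  A non-edge of \<open>C \<supseteq> S\<close> either lies inside \<open>S\<close> or joins a vertex of \<open>C - S\<close> to one of its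
  non-neighbours in \<open>S\<close> (or lies inside \<open>C - S\<close>, and is ignored). If \<open>C\<close> contains \<open>S\<close> and
  \<open>v i\<close> and has more than \<open>lb\<close> vertices, then \<open>C - S\<close> has at least \<open>lb - card S\<close> vertices besides
  \<open>v i\<close>, and these contribute at least as much as the first \<open>lb - card S\<close> vertices of the ordering.
\<close>

text \<open>Induction on \<open>m\<close>, splitting off \<open>Max J\<close>: a set of at least
  \<open>Suc m\<close> positive integers has a maximum of at least \<open>Suc m\<close>, so by
  monotonicity its term dominates \<open>f (Suc m)\<close>.\<close>

lemma sum_initial_segment_le:
  fixes f :: "nat \<Rightarrow> nat"
  assumes "mono_on {1..n} f" and "J \<subseteq> {1..n}" and "m \<le> card J"
  shows "sum f {1..m} \<le> sum f J"
  using assms(2,3)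
proof (induction m arbitrary: J)
  case (Suc m)
  have fin: "finite J" and ne: "J \<noteq> {}"
    using Suc.prems finite_subset by auto
  let ?x = "Max J"
  have x: "?x \<in> J" using fin ne by simp
  have "J \<subseteq> {1..?x}" using fin Suc.prems(1) by auto
  then have "card J \<le> ?x" using card_mono[of "{1..?x}" J] by simp
  then have "Suc m \<le> ?x" using Suc.prems(2) by simp
  then have "f (Suc m) \<le> f ?x"
    using x Suc.prems(1) by (intro mono_onD[OF assms(1)]) auto
  moreover have "sum f {1..m} \<le> sum f (J - {?x})"
    using Suc.prems x fin by (intro Suc.IH) auto
  moreover have "sum f J = f ?x + sum f (J - {?x})"
    using fin x by (rule sum.remove)
  ultimately show ?case by simp
qed simp

lemma nonedges_subset_Pow: "nonedges G A \<subseteq> Pow A"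
  by (auto simp: nonedges_def)

lemma nonedges_mono: "A \<subseteq> B \<Longrightarrow> nonedges G A \<subseteq> nonedges G B"
  unfolding nonedges_def by blast

text \<open>Exactly one end of a pair in \<open>?P\<close> lies in \<open>S\<close>, so the set
  \<open>{u, w}\<close> determines \<open>(u, w)\<close> and is not a non-edge inside
  \<open>S\<close>. Hence nothing is counted twice.\<close>

lemma card_nonedges_ge:
  assumes "finite C" and "S \<subseteq> C"
  shows "card (nonedges G S) + (\<Sum>u\<in>C - S. card (non_nbrs G S u)) \<le> card (nonedges G C)"
proof -
  let ?P = "SIGMA u:C - S. non_nbrs G S u"
  let ?X = "(\<lambda>(u, w). {u, w}) ` ?P"
  have finC: "finite (nonedges G C)"
    using assms(1) nonedges_subset_Pow finite_subset by (metis finite_Pow_iff)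
  have finN: "finite (non_nbrs G S u)" for u
    using finite_subset[OF assms(2,1)] by (simp add: non_nbrs_def)
  have "inj_on (\<lambda>(u, w). {u, w}) ?P"
    by (auto simp: inj_on_def non_nbrs_def doubleton_eq_iff)
  then have "card ?X = (\<Sum>u\<in>C - S. card (non_nbrs G S u))"
    using finN assms(1) by (simp add: card_image)
  moreover have "?X \<subseteq> nonedges G C"
    using assms(2) unfolding nonedges_def non_nbrs_def by fastforce
  moreover have "nonedges G S \<subseteq> nonedges G C"
    using assms(2) by (rule nonedges_mono)
  moreover have "nonedges G S \<inter> ?X = {}"
    using nonedges_subset_Pow[of G S] by auto
  ultimately show ?thesis
    using card_mono[OF finC, of "nonedges G S \<union> ?X"] finC
    by (simp add: card_Un_disjoint finite_subset)
qed

theorem mainTheorem3: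
  fixes G :: "'a pair_pre_digraph" and S :: "'a set" and v :: "nat \<Rightarrow> 'a" and k lb i :: nat
  assumes "pair_graph G"
    and "k \<ge> 1"
    and "defective_clique G k S"
    and "bij_betw v {1..card (pverts G - S)} (pverts G - S)"
    and "mono_on {1..card (pverts G - S)} (\<lambda>j. card (non_nbrs G S (v j)))"
    and "i \<in> {1..card (pverts G - S)}"
    and "int i > int lb - int (card S)"
    and "int (card (non_nbrs G S (v i))) >
           int k - int (card (nonedges G S))
             - (\<Sum>j = 1..int lb - int (card S). int (card (non_nbrs G S (v (nat j)))))"
  shows "can_be_removed G k S lb (v i)"
  unfolding can_be_removed_def
proof
  assume "\<exists>C. defective_clique G k C \<and> card C > lb \<and> S \<union> {v i} \<subseteq> C"
  then obtain C where C: "C \<subseteq> pverts G" "card (nonedges G C) \<le> k" "card C > lb"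
    "S \<subseteq> C" "v i \<in> C"
    by (auto simp: defective_clique_def)
  interpret pair_graph G by fact
  have finC: "finite C" using C(1) pair_finite_verts by (rule finite_subset)
  have finS: "finite S" using finC C(4) finite_subset by blast
  define n where "n = card (pverts G - S)"
  define d where "d = (\<lambda>u. card (non_nbrs G S u))"
  define m where "m = lb - card S"
  \<comment> \<open>The vertex \<open>v i\<close> is left out because its own term
    \<open>d (v i)\<close> is added separately.\<close>
  define J where "J = {j \<in> {1..n}. v j \<in> C - S - {v i}}"
  have bij: "bij_betw v {1..n} (pverts G - S)" using assms(4) by (simp add: n_def)
  then have "v i \<notin> S" using assms(6) by (auto simp: bij_betw_def n_def)
  have "v ` J = v ` {1..n} \<inter> (C - S - {v i})"
    unfolding J_def by fast
  also have "\<dots> = C - S - {v i}"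
    using C(1) unfolding bij_betw_imp_surj_on[OF bij] by blast
  finally have bijJ: "bij_betw v J (C - S - {v i})"
    by (rule bij_betw_subset[OF bij, rotated]) (auto simp: J_def)
  have "card J = card C - card S - 1"
    using bij_betw_same_card[OF bijJ] C(4,5) \<open>v i \<notin> S\<close> finC finS
    by (simp add: card_Diff_subset)
  \<comment> \<open>The strict bound \<open>card C > lb\<close> makes up for the 1 lost by excluding
    \<open>v i\<close>.\<close>
  then have "m \<le> card J" using C(3) by (simp add: m_def)
  then have "(\<Sum>j=1..m. d (v j)) \<le> (\<Sum>j\<in>J. d (v j))"
    using assms(5) by (intro sum_initial_segment_le) (auto simp: d_def n_def J_def)
  also have "\<dots> = sum d (C - S - {v i})"
    by (rule sum.reindex_bij_betw[OF bijJ])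
  finally have "d (v i) + (\<Sum>j=1..m. d (v j)) \<le> sum d (C - S)"
    using sum.remove[of "C - S" "v i" d] finC C(5) \<open>v i \<notin> S\<close> by simp
  then have "card (nonedges G S) + d (v i) + (\<Sum>j=1..m. d (v j)) \<le> k"
    using card_nonedges_ge[OF finC C(4), of G] C(2) by (simp add: d_def)
  \<comment> \<open>If \<open>lb < card S\<close>, the integer range is empty, and truncated
    subtraction gives \<open>m = 0\<close>, so both sums vanish.\<close>
  moreover have "(\<Sum>j = 1..int lb - int (card S). int (d (v (nat j)))) = int (\<Sum>j=1..m. d (v j))"
    unfolding of_nat_sum
    by (rule sum.reindex_bij_witness[where i = int and j = nat]) (auto simp: m_def)
  ultimately show False using assms(8) unfolding d_def by linarith
qed

end
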